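(* Let $H$ be an abelian group and let $\mathbf{u}=\{u_n\}$ be a $T$-sequence in $H$. Then: (1) $(H,\mathbf{u})$ is maximally almost-periodic if and only if $s_{\mathbf{u}}(H_d^{\wedge})$ is dense in $H_d^{\wedge}$. (2) $(H,\mathbf{u})$ is minimally almost-periodic if and only if $H=\langle\mathbf{u}\rangle$ and $s_{\mathbf{u}}(H_d^{\wedge})=\{0\}$.
   Context: $\mathbb{T}=\{z\in\mathbb{C}:|z|=1\}$. For an abelian topological group $Y$, $\widehat{Y}$ is the group of continuous characters $Y\to\mathbb{T}$ (written additively), and $Y^{\wedge}$ is $\widehat{Y}$ with the compact-open topology. $H_d$ is $H$ with the discrete topology, so $H_d^{\wedge}$ is the compact group of all homomorphisms $H\to\mathbb{T}$. Here $s_{\mathbf{u}}(H_d^{\wedge})=\{x\in H_d^{\wedge}: x(u_n)\to1\}$ (elements of $H$ being regarded as characters of $H_d^{\wedge}$). $\langle\mathbf{u}\rangle$ is the subgroup of $H$ generated by the set $\{u_n\}$. A sequence $\mathbf{u}=\{u_n\}$ in $H$ is a $T$-sequence if there is a Hausdorff group topology on $H$ in which $u_n\to0$; then $(H,\mathbf{u})$ denotes $H$ with the finest group topology in which $u_n\to0$. The von Neumann radical of $Y$ is $\mathbf{n}(Y)=\bigcap_{\chi\in\widehat{Y}}\ker\chi$. $Y$ is maximally almost-periodic if $\mathbf{n}(Y)=\{0\}$ and minimally almost-periodic if $\mathbf{n}(Y)=Y$. *)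

theory Defs
  imports
    "HOL-Analysis.Analysis"
    "HOL-Computational_Algebra.Group_Closure"
begin

text \<open>
  The abelian group is the whole type \<open>'a::ab_group_add\<close>; since several topologies on it are
  compared, topologies are values of type \<open>'a topology\<close> rather than type class instances.
\<close>

definition group_topology :: "'a::ab_group_add topology \<Rightarrow> bool" where
  "group_topology T \<longleftrightarrow>
     topspace T = UNIV \<and>
     continuous_map (prod_topology T T) T (\<lambda>(x, y). x + y) \<and>
     continuous_map T T uminus"

definition T_sequence :: "(nat \<Rightarrow> 'a::ab_group_add) \<Rightarrow> bool" where
  "T_sequence u \<longleftrightarrow>
     (\<exists>T. group_topology T \<and> Hausdorff_space T \<and> limitin T u 0 sequentially)"

definition is_finest_null_topology :: "(nat \<Rightarrow> 'a::ab_group_add) \<Rightarrow> 'a topology \<Rightarrow> bool" where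
  "is_finest_null_topology u T \<longleftrightarrow>
     group_topology T \<and> limitin T u 0 sequentially \<and>
     (\<forall>S. group_topology S \<and> limitin S u 0 sequentially \<longrightarrow> (\<forall>U. openin S U \<longrightarrow> openin T U))"

text \<open>The description is justified by \<open>finest_null_topology\<close> and
  \<open>is_finest_null_topology_unique\<close> below.\<close>

definition finest_null_topology :: "(nat \<Rightarrow> 'a::ab_group_add) \<Rightarrow> 'a topology" where
  "finest_null_topology u = (THE T. is_finest_null_topology u T)"

text \<open>Characters are circle-valued functions, with pointwise multiplication as the group operation;
  the zero of the (additively written) dual group is thus the constant function 1.\<close>

definition characters :: "'a::ab_group_add topology \<Rightarrow> ('a \<Rightarrow> complex) set" where
  "characters T =
     {\<phi>. continuous_map T (top_of_set (sphere 0 1)) \<phi> \<and> (\<forall>x y. \<phi> (x + y) = \<phi> x * \<phi> y)}"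

definition trivial_character :: "'a::ab_group_add \<Rightarrow> complex" where
  "trivial_character = (\<lambda>_. 1)"

text \<open>The compact-open topology on the character group, by its usual subbase.\<close>

definition dual_topology :: "'a::ab_group_add topology \<Rightarrow> ('a \<Rightarrow> complex) topology" where
  "dual_topology T =
     topology_generated_by
       {{\<phi> \<in> characters T. \<phi> ` K \<subseteq> V} | K V. compactin T K \<and> openin (top_of_set (sphere 0 1)) V}"

abbreviation discrete_dual :: "('a::ab_group_add \<Rightarrow> complex) topology" where
  "discrete_dual \<equiv> dual_topology (discrete_topology UNIV)"

definition s_set :: "(nat \<Rightarrow> 'a::ab_group_add) \<Rightarrow> ('a \<Rightarrow> complex) set" where
  "s_set u = {x \<in> topspace discrete_dual. (\<lambda>n. x (u n)) \<longlonglongrightarrow> 1}"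

definition von_Neumann_radical :: "'a::ab_group_add topology \<Rightarrow> 'a set" where
  "von_Neumann_radical T = (\<Inter>\<phi>\<in>characters T. {x. \<phi> x = 1})"

definition maximally_almost_periodic :: "'a::ab_group_add topology \<Rightarrow> bool" where
  "maximally_almost_periodic T \<longleftrightarrow> von_Neumann_radical T = {0}"

definition minimally_almost_periodic :: "'a::ab_group_add topology \<Rightarrow> bool" where
  "minimally_almost_periodic T \<longleftrightarrow> von_Neumann_radical T = topspace T"

lemma topspace_dual_topology: "topspace (dual_topology T) = characters T"
proof -
  have "\<exists>K V. characters T = {\<phi> \<in> characters T. \<phi> ` K \<subseteq> V} \<and> compactin T K \<and>
          openin (top_of_set (sphere (0::complex) 1)) V"
    by (intro exI[of _ "{}"]) auto
  then have "characters T \<in> {{\<phi> \<in> characters T. \<phi> ` K \<subseteq> V} | K V.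
      compactin T K \<and> openin (top_of_set (sphere 0 1)) V}"
    by blast
  then show ?thesis
    unfolding dual_topology_def topology_generated_by_topspace by blast
qed

lemma characters_discrete:
  "characters (discrete_topology UNIV) =
     {\<phi> :: 'a::ab_group_add \<Rightarrow> complex. (\<forall>x. cmod (\<phi> x) = 1) \<and> (\<forall>x y. \<phi> (x + y) = \<phi> x * \<phi> y)}"
  by (auto simp: characters_def)

lemma is_finest_null_topology_unique:
  assumes "is_finest_null_topology u S" "is_finest_null_topology u T"
  shows "S = T"
  using assms unfolding is_finest_null_topology_def topology_eq by blast

lemma sup_group_topology:
  fixes \<T> :: "'a::ab_group_add topology set"
  assumes ne: "\<T> \<noteq> {}" and grp: "\<And>T. T \<in> \<T> \<Longrightarrow> group_topology T"
  shows "group_topology (topology_generated_by (\<Union>T\<in>\<T>. Collect (openin T)))" (is "group_topology ?S")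
proof -
  have top: "topspace T = UNIV" if "T \<in> \<T>" for T
    using grp[OF that] by (simp add: group_topology_def)
  have un: "(\<Union>(\<Union>T\<in>\<T>. Collect (openin T))) = UNIV"
    using ne top openin_topspace by fastforce
  have S: "topspace ?S = UNIV"
    using un by simp
  have sub: "openin ?S U" if "T \<in> \<T>" "openin T U" for T U
    using that by (intro topology_generated_by_Basis) auto
  have id: "continuous_map ?S T (\<lambda>x. x)" if "T \<in> \<T>" for T
    using that sub S top by (auto simp: continuous_map_def)
  have "continuous_map (prod_topology ?S ?S) ?S (\<lambda>(x, y). x + y)"
  proof (rule continuous_on_generated_topo)
    fix U assume "U \<in> (\<Union>T\<in>\<T>. Collect (openin T))"
    then obtain T where T: "T \<in> \<T>" "openin T U" by auto
    have add: "continuous_map (prod_topology T T) T (\<lambda>(x, y). x + y)"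
      using grp[OF T(1)] by (simp add: group_topology_def)
    have "continuous_map (prod_topology ?S ?S) (prod_topology T T) (\<lambda>(x, y). (x, y))"
      using id[OF T(1)] by (subst continuous_map_prod_top) simp
    from continuous_map_compose[OF this add]
    have "continuous_map (prod_topology ?S ?S) T (\<lambda>(x, y). x + y)"
      by (simp add: o_def case_prod_unfold)
    then show "openin (prod_topology ?S ?S)
        ((\<lambda>(x, y). x + y) -` U \<inter> topspace (prod_topology ?S ?S))"
      using T(2) unfolding continuous_map_alt by blast
  qed (use un in auto)
  moreover have "continuous_map ?S ?S uminus"
  proof (rule continuous_on_generated_topo)
    fix U assume "U \<in> (\<Union>T\<in>\<T>. Collect (openin T))"
    then obtain T where T: "T \<in> \<T>" "openin T U" by auto
    have "continuous_map T T uminus"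
      using grp[OF T(1)] by (simp add: group_topology_def)
    from continuous_map_compose[OF id[OF T(1)] this]
    have "continuous_map ?S T uminus"
      by (simp add: o_def)
    then show "openin ?S (uminus -` U \<inter> topspace ?S)"
      using T(2) unfolding continuous_map_alt by blast
  qed (use un in auto)
  ultimately show ?thesis
    using S by (simp add: group_topology_def)
qed

lemma limitin_generated_topology:
  assumes "\<And>U. U \<in> \<B> \<Longrightarrow> l \<in> U \<Longrightarrow> eventually (\<lambda>n. f n \<in> U) F" and "l \<in> \<Union>\<B>"
  shows "limitin (topology_generated_by \<B>) f l F"
proof -
  have "l \<in> U \<longrightarrow> eventually (\<lambda>n. f n \<in> U) F" if "generate_topology_on \<B> U" for U
    using that
  proof induction
    case (Int a b)
    then show ?case by (auto elim: eventually_elim2)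
  next
    case (UN K)
    show ?case
    proof
      assume "l \<in> \<Union>K"
      then obtain k where k: "k \<in> K" "l \<in> k" by blast
      with UN.IH have "eventually (\<lambda>n. f n \<in> k) F" by blast
      then show "eventually (\<lambda>n. f n \<in> \<Union>K) F"
        by (rule eventually_mono) (use k in blast)
    qed
  qed (use assms(1) in auto)
  then show ?thesis
    using assms(2) by (auto simp: limitin_def openin_topology_generated_by_iff)
qed

lemma finest_null_topology:
  assumes "T_sequence u"
  shows "is_finest_null_topology u (finest_null_topology u)"
proof -
  define \<T> where "\<T> = {T. group_topology T \<and> limitin T u 0 sequentially}"
  let ?\<B> = "\<Union>T\<in>\<T>. Collect (openin T)"
  let ?S = "topology_generated_by ?\<B>"
  have ne: "\<T> \<noteq> {}"
    using assms by (auto simp: \<T>_def T_sequence_def)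
  have "group_topology ?S"
    using ne by (rule sup_group_topology) (simp add: \<T>_def)
  moreover have "limitin ?S u 0 sequentially"
  proof (rule limitin_generated_topology)
    fix U assume "U \<in> ?\<B>" and "0 \<in> U"
    then show "eventually (\<lambda>n. u n \<in> U) sequentially"
      by (auto simp: \<T>_def limitin_def)
  next
    have "0 \<in> topspace ?S"
      using \<open>group_topology ?S\<close> unfolding group_topology_def by blast
    then show "0 \<in> \<Union>?\<B>"
      unfolding topology_generated_by_topspace .
  qed
  moreover have "openin ?S U" if "group_topology T" "limitin T u 0 sequentially" "openin T U" for T U
    using that by (intro topology_generated_by_Basis) (auto simp: \<T>_def)
  ultimately have "is_finest_null_topology u ?S"
    unfolding is_finest_null_topology_def by blast
  then show ?thesis
    unfolding finest_null_topology_def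
    by (rule theI) (rule is_finest_null_topology_unique[OF _ \<open>is_finest_null_topology u ?S\<close>])
qed

end

theory Submission
  imports Defs "HOL-Library.Poly_Mapping"
begin

text \<open>
  The two parts rest on one observation: the continuous characters of the group with the finest
  topology making \<open>u\<close> a null sequence are exactly the homomorphisms to the circle along which \<open>u\<close>
  tends to 1 (\<open>characters_finest_null_topology\<close>). The von Neumann radical is therefore the common
  kernel of \<open>s_set u\<close>.

  For part (1), the radical is trivial if and only if \<open>s_set u\<close> separates the points of the group, and
  for a set of characters closed under products this is equivalent to density in the dual of the
  discrete group (\<open>dense_iff_separating\<close>). That separation follows from density uses that the
  characters of a discrete abelian group separate its points. That density follows from separation is
  usually derived from Pontryagin duality. Here it comes from a direct argument of Kronecker type
  (\<open>simultaneous_approximation\<close>): the constant term of a trigonometric polynomial is its mean over any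
  separating semigroup of characters, and weighting by a product of Fejer kernels centred at a given
  character \<open>\<phi>\<close> shows that the set must come close to \<open>\<phi>\<close> at any finitely many points.

  For part (2), the radical is the whole group if and only if \<open>s_set u\<close> is trivial. In that case \<open>u\<close>
  generates the group: otherwise some nontrivial character is trivial on the subgroup generated by \<open>u\<close>
  (\<open>character_separating_subgroup\<close>), and it belongs to \<open>s_set u\<close>.
\<close>

section \<open>Characters of a discrete abelian group\<close>

lemma character_norm: "\<phi> \<in> characters (discrete_topology UNIV) \<Longrightarrow> cmod (\<phi> x) = 1"
  and character_add: "\<phi> \<in> characters (discrete_topology UNIV) \<Longrightarrow> \<phi> (x + y) = \<phi> x * \<phi> y"
  by (simp_all add: characters_discrete)

lemma character_zero:
  assumes "\<phi> \<in> characters (discrete_topology UNIV)"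
  shows "\<phi> 0 = 1"
  using character_add[OF assms, of 0 0] character_norm[OF assms, of 0] by auto

lemma character_uminus:
  assumes "\<phi> \<in> characters (discrete_topology UNIV)"
  shows "\<phi> (- x) = cnj (\<phi> x)"
proof -
  have "\<phi> (- x) * \<phi> x = 1"
    using character_add[OF assms, of "- x" x] character_zero[OF assms] by simp
  moreover have "cnj (\<phi> x) * \<phi> x = 1"
    using character_norm[OF assms, of x] complex_norm_square[of "\<phi> x"] by (simp add: mult.commute)
  moreover have "\<phi> x \<noteq> 0" using character_norm[OF assms, of x] by auto
  ultimately show ?thesis by (metis mult_right_cancel)
qed

text \<open>A type in class \<open>ab_group_add\<close> carries no multiplication by scalars, so the multiples
  needed for cyclic subgroups are introduced here.\<close>

primrec nat_multiple :: "nat \<Rightarrow> 'a::ab_group_add \<Rightarrow> 'a" where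
  "nat_multiple 0 y = 0"
| "nat_multiple (Suc n) y = y + nat_multiple n y"

lemma nat_multiple_add: "nat_multiple (m + n) y = nat_multiple m y + nat_multiple n y"
  by (induction m) (simp_all add: algebra_simps)

text \<open>A character of a subgroup is encoded by its graph: a subgroup of the product with the circle that
  meets \<open>{0} \<times> \<complex>\<close> only in the unit. Extension of characters is then inclusion of sets, which is
  the order Zorn's lemma asks for; closure under differences encodes both group operations.\<close>

definition character_graph :: "('a::ab_group_add \<times> complex) set \<Rightarrow> bool" where
  "character_graph R \<longleftrightarrow>
     (0, 1) \<in> R \<and>
     (\<forall>a c. (a, c) \<in> R \<longrightarrow> cmod c = 1) \<and>
     (\<forall>a c b d. (a, c) \<in> R \<longrightarrow> (b, d) \<in> R \<longrightarrow> (a - b, c / d) \<in> R) \<and>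
     (\<forall>c. (0, c) \<in> R \<longrightarrow> c = 1)"

context
  fixes R :: "('a::ab_group_add \<times> complex) set"
  assumes R: "character_graph R"
begin

lemma character_graph_norm: "(a, c) \<in> R \<Longrightarrow> cmod c = 1"
  using R by (auto simp: character_graph_def)

lemma character_graph_diff: "(a, c) \<in> R \<Longrightarrow> (b, d) \<in> R \<Longrightarrow> (a - b, c / d) \<in> R"
  using R by (auto simp: character_graph_def)

lemma character_graph_zero: "(0, c) \<in> R \<longleftrightarrow> c = 1"
  using R by (auto simp: character_graph_def)

lemma character_graph_uminus: "(a, c) \<in> R \<Longrightarrow> (- a, 1 / c) \<in> R"
  using character_graph_diff[of 0 1 a c] by (simp add: character_graph_zero)

lemma character_graph_add: "(a, c) \<in> R \<Longrightarrow> (b, d) \<in> R \<Longrightarrow> (a + b, c * d) \<in> R"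
  using character_graph_diff[of a c "- b" "1 / d"] character_graph_uminus by simp

lemma character_graph_unique: "(a, c) \<in> R \<Longrightarrow> (a, d) \<in> R \<Longrightarrow> c = d"
  using character_graph_diff[of a c a d] character_graph_norm[of a d]
  by (auto simp: character_graph_zero)

text \<open>A graph can be enlarged by the pair \<open>(y, z)\<close> as soon as \<open>z\<close> respects the relations that the
  multiples of \<open>y\<close> satisfy modulo the domain. The new graph is the subgroup generated; a relation in
  it between two multiples of \<open>y\<close> reduces, after cancelling the smaller one, to a single multiple.\<close>

lemma character_graph_adjoin:
  assumes z: "cmod z = 1"
    and compat: "\<And>n c. (nat_multiple n y, c) \<in> R \<Longrightarrow> z ^ n = c"
  obtains R' where "character_graph R'" "R \<subseteq> R'" "(y, z) \<in> R'"
proof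
  define R' where "R' = {(a + nat_multiple n y - nat_multiple m y, c * z ^ n / z ^ m) | a c n m. (a, c) \<in> R}"
  have z0: "z \<noteq> 0" using z by auto
  have memI: "(a', c') \<in> R'"
    if "(a, c) \<in> R" "a' = a + nat_multiple n y - nat_multiple m y" "c' = c * z ^ n / z ^ m" for a c n m a' c'
    using that unfolding R'_def by blast
  show "R \<subseteq> R'"
    by (auto intro!: memI[where n = 0 and m = 0])
  show "(y, z) \<in> R'"
    by (rule memI[of 0 1 _ 1 0]) (auto simp: character_graph_zero)
  show "character_graph R'"
    unfolding character_graph_def
  proof (intro conjI allI impI)
    show "(0, 1) \<in> R'"
      using \<open>R \<subseteq> R'\<close> character_graph_zero by blast
  next
    fix a c assume "(a, c) \<in> R'"
    then show "cmod c = 1"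
      by (auto simp: R'_def norm_mult norm_divide norm_power z character_graph_norm)
  next
    fix a c b d assume "(a, c) \<in> R'" "(b, d) \<in> R'"
    then obtain a1 c1 n1 m1 b1 d1 n2 m2 where
      ac: "(a1, c1) \<in> R" "a = a1 + nat_multiple n1 y - nat_multiple m1 y" "c = c1 * z ^ n1 / z ^ m1" and
      bd: "(b1, d1) \<in> R" "b = b1 + nat_multiple n2 y - nat_multiple m2 y" "d = d1 * z ^ n2 / z ^ m2"
      unfolding R'_def by blast
    show "(a - b, c / d) \<in> R'"
    proof (rule memI[OF character_graph_diff[OF ac(1) bd(1)]])
      show "a - b = a1 - b1 + nat_multiple (n1 + m2) y - nat_multiple (m1 + n2) y"
        by (simp add: ac bd nat_multiple_add)
      show "c / d = c1 / d1 * z ^ (n1 + m2) / z ^ (m1 + n2)"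
        by (simp add: ac bd power_add mult.commute mult.left_commute)
    qed
  next
    fix w assume "(0, w) \<in> R'"
    then obtain a c n m where
      ac: "(a, c) \<in> R" "0 = a + nat_multiple n y - nat_multiple m y" "w = c * z ^ n / z ^ m"
      unfolding R'_def by blast
    have c0: "c \<noteq> 0" using character_graph_norm[OF ac(1)] by auto
    show "w = 1"
    proof (cases "m \<le> n")
      case True
      then obtain k where n: "n = m + k" using le_Suc_ex by blast
      have "nat_multiple k y = - a"
        using ac(2) by (simp add: n nat_multiple_add algebra_simps eq_neg_iff_add_eq_0)
      then have "z ^ k = 1 / c"
        using compat[of k "1 / c"] character_graph_uminus[OF ac(1)] by simp
      then show ?thesis using c0 z0 by (simp add: ac(3) n power_add)
    next
      case False
      then obtain k where m: "m = n + k" using le_Suc_ex nat_le_linear by blast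
      have "nat_multiple k y = a"
        using ac(2) by (simp add: m nat_multiple_add algebra_simps)
      then have "z ^ k = c"
        using compat[of k c] ac(1) by simp
      then show ?thesis using c0 z0 by (simp add: ac(3) m power_add)
    qed
  qed
qed

text \<open>The values that may be prescribed at \<open>y\<close>: if no positive multiple of \<open>y\<close> lies in the domain, every
  unit will do. Otherwise let \<open>n\<close> be the least positive one and \<open>w\<close> the value there; the multiples of
  \<open>y\<close> in the domain are the multiples of \<open>n y\<close>, so every \<open>n\<close>-th root of \<open>w\<close> will do.\<close>

lemma compatible_value:
  obtains (free) "\<And>n c. (nat_multiple n y, c) \<in> R \<Longrightarrow> n = 0"
  | (torsion) n w where "n > 0" "(nat_multiple n y, w) \<in> R"
      "\<And>z k c. z ^ n = w \<Longrightarrow> (nat_multiple k y, c) \<in> R \<Longrightarrow> z ^ k = c"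
proof (cases "\<exists>n>0. nat_multiple n y \<in> Domain R")
  case False
  show ?thesis
  proof (rule free)
    fix n c assume "(nat_multiple n y, c) \<in> R"
    then have "nat_multiple n y \<in> Domain R" by (rule DomainI)
    with False show "n = 0" by auto
  qed
next
  case True
  define n where "n = (LEAST n. n > 0 \<and> nat_multiple n y \<in> Domain R)"
  have n: "n > 0" "nat_multiple n y \<in> Domain R"
    unfolding n_def using LeastI_ex[OF True] by auto
  have least: "nat_multiple k y \<notin> Domain R" if "0 < k" "k < n" for k
    using not_less_Least[of k] that unfolding n_def by blast
  obtain w where w: "(nat_multiple n y, w) \<in> R" using n(2) by blast
  have power: "z ^ k = c" if z: "z ^ n = w" and k: "(nat_multiple k y, c) \<in> R" for z k c
    using k
  proof (induction k arbitrary: c rule: less_induct)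
    case (less k)
    consider "k = 0" | "0 < k" "k < n" | "n \<le> k" by linarith
    then show ?case
    proof cases
      case 1
      with less.prems show ?thesis by (simp add: character_graph_zero)
    next
      case 2
      with less.prems least show ?thesis by blast
    next
      case 3
      then obtain j where j: "k = n + j" using le_Suc_ex by blast
      have "(nat_multiple j y, c / w) \<in> R"
        using character_graph_diff[OF less.prems w] by (simp add: j nat_multiple_add)
      moreover have "j < k" using n(1) j by simp
      ultimately have "z ^ j = c / w" using less.IH[of j] by blast
      moreover have "w \<noteq> 0" using character_graph_norm[OF w] by auto
      ultimately show ?thesis by (simp add: j power_add z)
    qed
  qed
  show ?thesis
    by (rule torsion[OF n(1) w power])
qed

end

lemma circle_root:
  assumes "cmod w = 1" "n > 0"
  obtains z where "cmod z = 1" "z ^ n = w"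
proof
  have "cis (Arg w) = w"
    using cis_Arg[of w] assms(1) by (cases "w = 0") (auto simp: sgn_div_norm)
  then show "cis (Arg w / n) ^ n = w"
    using assms(2) by (simp add: Complex.DeMoivre)
  show "cmod (cis (Arg w / n)) = 1"
    by simp
qed

text \<open>This is where divisibility of the circle enters: a root of the prescribed value always exists, so
  a graph whose domain misses a point can still be enlarged.\<close>

lemma maximal_character_graph_total:
  assumes R: "character_graph R"
    and max: "\<And>R'. character_graph R' \<Longrightarrow> R \<subseteq> R' \<Longrightarrow> R' = R"
  shows "Domain R = UNIV"
proof -
  have "y \<in> Domain R" for y
  proof -
    have "\<exists>z. cmod z = 1 \<and> (\<forall>n c. (nat_multiple n y, c) \<in> R \<longrightarrow> z ^ n = c)"
    proof (cases rule: compatible_value[OF R, of y])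
      case 1
      have "1 ^ n = c" if "(nat_multiple n y, c) \<in> R" for n c
        using character_graph_zero[OF R] 1[OF that] that by simp
      then show ?thesis by (intro exI[of _ 1]) simp
    next
      case (2 n w)
      obtain z where "cmod z = 1" "z ^ n = w"
        using circle_root 2(1) character_graph_norm[OF R 2(2)] by blast
      with 2(3) show ?thesis by blast
    qed
    then obtain z where z: "cmod z = 1" "\<And>n c. (nat_multiple n y, c) \<in> R \<Longrightarrow> z ^ n = c"
      by blast
    obtain R' where "character_graph R'" "R \<subseteq> R'" "(y, z) \<in> R'"
      by (rule character_graph_adjoin[OF R z])
    with max show ?thesis by blast
  qed
  then show ?thesis by blast
qed

text \<open>Zorn's lemma: the union of a chain of graphs is a graph, since any two of its elements lie in a
  common member of the chain.\<close>

lemma character_graph_extends: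
  fixes R :: "('a::ab_group_add \<times> complex) set"
  assumes R: "character_graph R"
  obtains \<phi> where "\<phi> \<in> characters (discrete_topology (UNIV :: 'a set))" "\<And>a c. (a, c) \<in> R \<Longrightarrow> \<phi> a = c"
proof -
  have "\<exists>M\<in>{M. character_graph M \<and> R \<subseteq> M}. \<forall>X\<in>{M. character_graph M \<and> R \<subseteq> M}. M \<subseteq> X \<longrightarrow> X = M"
  proof (rule subset_Zorn_nonempty)
    fix \<C> assume ne: "\<C> \<noteq> {}" and ch: "subset.chain {M. character_graph M \<and> R \<subseteq> M} \<C>"
    have C: "character_graph M" "R \<subseteq> M" if "M \<in> \<C>" for M
      using ch that unfolding subset.chain_def by blast+
    have directed: "\<exists>M\<in>\<C>. p \<in> M \<and> q \<in> M" if "p \<in> \<Union>\<C>" "q \<in> \<Union>\<C>" for p q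
    proof -
      obtain P Q where "p \<in> P" "q \<in> Q" "P \<in> \<C>" "Q \<in> \<C>" using \<open>p \<in> \<Union>\<C>\<close> \<open>q \<in> \<Union>\<C>\<close> by auto
      moreover have "P \<subseteq> Q \<or> Q \<subseteq> P"
        using ch \<open>P \<in> \<C>\<close> \<open>Q \<in> \<C>\<close> by (simp add: subset_chain_def)
      ultimately show ?thesis by auto
    qed
    have "character_graph (\<Union>\<C>)"
      unfolding character_graph_def
    proof (intro conjI allI impI)
      show "(0, 1) \<in> \<Union>\<C>"
        using ne C(1) character_graph_zero by blast
      show "cmod c = 1" if "(a, c) \<in> \<Union>\<C>" for a c
        using that C(1) character_graph_norm by blast
      show "(a - b, c / d) \<in> \<Union>\<C>" if "(a, c) \<in> \<Union>\<C>" "(b, d) \<in> \<Union>\<C>" for a c b d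
        using directed[OF that] C(1) character_graph_diff by blast
      show "c = 1" if "(0, c) \<in> \<Union>\<C>" for c
        using that C(1) character_graph_zero by blast
    qed
    with ne C(2) show "\<Union>\<C> \<in> {M. character_graph M \<and> R \<subseteq> M}" by blast
  qed (use R in auto)
  then obtain M where M: "character_graph M" "R \<subseteq> M"
    and "\<forall>X\<in>{M. character_graph M \<and> R \<subseteq> M}. M \<subseteq> X \<longrightarrow> X = M"
    by auto
  then have max: "X = M" if "character_graph X" "M \<subseteq> X" for X
    using that by auto
  have "\<forall>x. \<exists>c. (x, c) \<in> M"
    using maximal_character_graph_total[OF M(1) max] by blast
  then obtain \<phi> where \<phi>: "\<And>x. (x, \<phi> x) \<in> M" by metis
  show thesis
  proof
    show "\<phi> \<in> characters (discrete_topology UNIV)"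
      unfolding characters_discrete
      using character_graph_norm[OF M(1) \<phi>]
        character_graph_unique[OF M(1) \<phi> character_graph_add[OF M(1) \<phi> \<phi>]] by blast
    show "\<phi> a = c" if "(a, c) \<in> R" for a c
      using character_graph_unique[OF M(1) \<phi>] that M(2) by blast
  qed
qed

text \<open>The trivial character of the generated subgroup is first extended to \<open>x\<close> with a value other than 1,
  which is possible because the order of \<open>x\<close> modulo the subgroup is not 1, and then to the whole group.\<close>

lemma character_separating_subgroup:
  fixes S :: "'a::ab_group_add set"
  assumes x: "x \<notin> group_closure S"
  shows "\<exists>\<phi>\<in>characters (discrete_topology UNIV). (\<forall>s\<in>S. \<phi> s = 1) \<and> \<phi> x \<noteq> 1"
proof -
  define R where "R = group_closure S \<times> {1 :: complex}"
  have R: "character_graph R"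
    by (auto simp: character_graph_def R_def intro: group_closure.diff)
  have "\<exists>z. cmod z = 1 \<and> z \<noteq> 1 \<and> (\<forall>n c. (nat_multiple n x, c) \<in> R \<longrightarrow> z ^ n = c)"
  proof (cases rule: compatible_value[OF R, of x])
    case 1
    \<comment> \<open>Every unit is compatible here; \<open>-1\<close> is one that differs from 1.\<close>
    have "(-1) ^ n = c" if "(nat_multiple n x, c) \<in> R" for n c
      using character_graph_zero[OF R] 1[OF that] that by simp
    then show ?thesis by (intro exI[of _ "-1"]) auto
  next
    case (2 n w)
    have w: "w = 1" using 2(2) by (simp add: R_def)
    have "n \<noteq> 1"
      using 2(2) x by (auto simp: R_def)
    then have n: "n \<ge> 2" using 2(1) by linarith
    \<comment> \<open>A primitive \<open>n\<close>-th root of unity, hence different from 1 because \<open>n \<ge> 2\<close>.\<close>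
    define z where "z = cis (2 * pi / n)"
    have "z ^ n = w" "cmod z = 1"
      using 2(1) by (simp_all add: z_def w Complex.DeMoivre)
    moreover have "z \<noteq> 1"
    proof
      assume "z = 1"
      then have "cos (2 * pi / n) = 1" by (simp add: z_def complex_eq_iff)
      moreover have "cos (2 * pi / n) < cos 0"
        using n by (intro cos_monotone_0_pi) (auto simp: field_simps)
      ultimately show False by simp
    qed
    ultimately show ?thesis using 2(3) by blast
  qed
  then obtain z where z: "cmod z = 1" "\<And>n c. (nat_multiple n x, c) \<in> R \<Longrightarrow> z ^ n = c"
    and z1: "z \<noteq> 1"
    by blast
  obtain R' where R': "character_graph R'" "R \<subseteq> R'" "(x, z) \<in> R'"
    by (rule character_graph_adjoin[OF R z])
  obtain \<phi> where \<phi>: "\<phi> \<in> characters (discrete_topology UNIV)" "\<And>a c. (a, c) \<in> R' \<Longrightarrow> \<phi> a = c"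
    using character_graph_extends[OF R'(1)] by blast
  have "(s, 1) \<in> R'" if "s \<in> S" for s
    using R'(2) that by (auto simp: R_def intro: group_closure.base)
  then have "\<forall>s\<in>S. \<phi> s = 1" using \<phi>(2) by blast
  moreover have "\<phi> x \<noteq> 1" using \<phi>(2)[OF R'(3)] z1 by simp
  ultimately show ?thesis using \<phi>(1) by blast
qed

section \<open>Means of trigonometric polynomials\<close>

lemma cesaro_unit_powers:
  fixes z :: complex
  assumes "cmod z = 1"
  shows "(\<lambda>n. (\<Sum>m<n. z ^ m) / of_nat n) \<longlonglongrightarrow> (if z = 1 then 1 else 0)"
proof (cases "z = 1")
  case True
  have "\<forall>\<^sub>F n in sequentially. (\<Sum>m<n. z ^ m) / of_nat n = 1"
    using eventually_gt_at_top[of 0] by eventually_elim (simp add: True)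
  then show ?thesis using True by (simp add: tendsto_eventually)
next
  case False
  have "(\<lambda>n. (\<Sum>m<n. z ^ m) / of_nat n) \<longlonglongrightarrow> 0"
  proof (rule Lim_null_comparison)
    show "\<forall>\<^sub>F n in sequentially.
        norm ((\<Sum>m<n. z ^ m) / of_nat n) \<le> 2 / cmod (z - 1) * inverse (real n)"
    proof (rule always_eventually, rule allI)
      fix n
      have "cmod (z ^ n - 1) \<le> 2"
        using norm_triangle_ineq4[of "z ^ n" 1] assms by (simp add: norm_power)
      then show "norm ((\<Sum>m<n. z ^ m) / of_nat n) \<le> 2 / cmod (z - 1) * inverse (real n)"
        using False by (simp add: geometric_sum norm_mult norm_inverse divide_inverse mult_right_mono)
    qed
    show "(\<lambda>n. 2 / cmod (z - 1) * inverse (real n)) \<longlonglongrightarrow> 0"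
      by (rule tendsto_mult_right_zero[OF lim_inverse_n])
  qed
  with False show ?thesis by simp
qed

text \<open>Closure under products is what makes the means over the powers \<open>s\<^sup>m\<close> with \<open>m \<ge> 0\<close> available,
  from which the constant term of a trigonometric polynomial is recovered.\<close>

locale separating_characters =
  fixes S :: "('a::ab_group_add \<Rightarrow> complex) set"
  assumes S_characters: "S \<subseteq> characters (discrete_topology UNIV)"
    and S_nonempty: "S \<noteq> {}"
    and S_mult: "\<eta> \<in> S \<Longrightarrow> \<psi> \<in> S \<Longrightarrow> (\<lambda>x. \<eta> x * \<psi> x) \<in> S"
    and S_separates: "x \<noteq> 0 \<Longrightarrow> \<exists>\<eta>\<in>S. \<eta> x \<noteq> 1"

context separating_characters
begin

lemma S_powers: "\<eta> \<in> S \<Longrightarrow> \<psi> \<in> S \<Longrightarrow> (\<lambda>x. \<eta> x * \<psi> x ^ m) \<in> S"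
proof (induction m)
  case (Suc m)
  then show ?case
    using S_mult[of "\<lambda>x. \<eta> x * \<psi> x ^ m" \<psi>] by (simp add: mult_ac)
qed simp

text \<open>The constant term of a trigonometric polynomial is its mean over a separating semigroup of characters,
  so it inherits nonnegativity. The mean is reached in finitely many steps: averaging over the translates
  by the powers of some \<open>s \<in> S\<close> removes in the limit exactly the terms at points where \<open>s\<close> is not 1,
  keeps the others, and preserves nonnegativity. Choosing \<open>s\<close> nontrivial at a nonzero frequency makes
  the support strictly smaller.\<close>

lemma constant_term_nonneg:
  assumes "finite J" "0 \<in> J" and "\<And>\<eta>. \<eta> \<in> S \<Longrightarrow> 0 \<le> Re (\<Sum>x\<in>J. c x * \<eta> x)"
  shows "0 \<le> Re (c 0)"
  using assms
proof (induction J rule: finite_psubset_induct)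
  case (psubset J)
  show ?case
  proof (cases "J = {0}")
    case True
    obtain \<eta> where "\<eta> \<in> S" using S_nonempty by blast
    then show ?thesis
      using psubset.prems(2)[of \<eta>] character_zero[of \<eta>] S_characters by (auto simp: True)
  next
    case False
    with psubset.prems(1) obtain g where g: "g \<in> J" "g \<noteq> 0" by blast
    then obtain s where s: "s \<in> S" "s g \<noteq> 1" using S_separates by blast
    have s_char: "s \<in> characters (discrete_topology UNIV)" using s S_characters by blast
    let ?J = "{x \<in> J. s x = 1}"
    show ?thesis
    proof (rule psubset.IH)
      show "?J \<subset> J" using s g by blast
      show "0 \<in> ?J" using psubset.prems(1) character_zero[OF s_char] by simp
    next
      fix \<eta> assume \<eta>: "\<eta> \<in> S"
      let ?A = "\<lambda>n x. (\<Sum>m<n. s x ^ m) / of_nat n"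
      have "(\<lambda>n. Re (\<Sum>x\<in>J. c x * \<eta> x * ?A n x)) \<longlonglongrightarrow>
          Re (\<Sum>x\<in>J. c x * \<eta> x * (if s x = 1 then 1 else 0))"
        by (intro tendsto_Re tendsto_sum tendsto_mult tendsto_const cesaro_unit_powers
            character_norm s_char)
      moreover have "0 \<le> Re (\<Sum>x\<in>J. c x * \<eta> x * ?A n x)" for n
      proof -
        have "(\<Sum>x\<in>J. c x * \<eta> x * ?A n x) = (\<Sum>x\<in>J. \<Sum>m<n. c x * (\<eta> x * s x ^ m)) / of_nat n"
          by (simp add: sum_distrib_left sum_divide_distrib mult.assoc)
        also have "\<dots> = (\<Sum>m<n. \<Sum>x\<in>J. c x * (\<eta> x * s x ^ m)) / of_nat n"
          by (subst sum.swap) simp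
        also have "Re \<dots> = (\<Sum>m<n. Re (\<Sum>x\<in>J. c x * (\<eta> x * s x ^ m))) / n"
          by (simp add: Re_divide_of_nat)
        also have "\<dots> \<ge> 0"
          using psubset.prems(2)[OF S_powers[OF \<eta> s(1)]] by (intro divide_nonneg_nonneg sum_nonneg) auto
        finally show ?thesis .
      qed
      ultimately have "0 \<le> Re (\<Sum>x\<in>J. c x * \<eta> x * (if s x = 1 then 1 else 0))"
        by (intro LIMSEQ_le_const) auto
      also have "(\<Sum>x\<in>J. c x * \<eta> x * (if s x = 1 then 1 else 0)) = (\<Sum>x\<in>?J. c x * \<eta> x)"
        using psubset.hyps by (intro sum.mono_neutral_cong_right) auto
      finally show "0 \<le> Re (\<Sum>x\<in>?J. c x * \<eta> x)" .
    qed
  qed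
qed

end

section \<open>Trigonometric polynomials as elements of the group ring\<close>

text \<open>The group ring is the ring of finitely supported functions with convolution; its elements serve as
  formal trigonometric polynomials, whose constant term is the coefficient at 0. Unlike the function it
  induces on a set of characters, a formal polynomial determines its coefficients by definition.\<close>

lemma poly_mapping_expand:
  "p = (\<Sum>x\<in>Poly_Mapping.keys p. Poly_Mapping.single x (Poly_Mapping.lookup p x))"
  by (rule poly_mapping_eqI)
    (simp add: lookup_sum lookup_single when_def in_keys_iff sum.delta)

lemma mult_expand:
  fixes p q :: "'a::ab_group_add \<Rightarrow>\<^sub>0 real"
  shows "p * q = (\<Sum>x\<in>Poly_Mapping.keys p. \<Sum>y\<in>Poly_Mapping.keys q.
    Poly_Mapping.single (x + y) (Poly_Mapping.lookup p x * Poly_Mapping.lookup q y))"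
  by (subst (1) poly_mapping_expand[of p], subst (1) poly_mapping_expand[of q])
    (simp add: sum_product mult_single)

definition nonneg_coeffs :: "('a \<Rightarrow>\<^sub>0 real) \<Rightarrow> bool" where
  "nonneg_coeffs p \<longleftrightarrow> (\<forall>x. 0 \<le> Poly_Mapping.lookup p x)"

lemma nonneg_coeffs_one: "nonneg_coeffs (1 :: 'a::ab_group_add \<Rightarrow>\<^sub>0 real)"
  by (simp add: nonneg_coeffs_def lookup_one when_def)

lemma nonneg_coeffs_single: "0 \<le> r \<Longrightarrow> nonneg_coeffs (Poly_Mapping.single x r)"
  by (simp add: nonneg_coeffs_def lookup_single when_def)

lemma nonneg_coeffs_sum: "(\<And>i. i \<in> I \<Longrightarrow> nonneg_coeffs (p i)) \<Longrightarrow> nonneg_coeffs (\<Sum>i\<in>I. p i)"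
  by (simp add: nonneg_coeffs_def lookup_sum sum_nonneg)

lemma nonneg_coeffs_mult:
  fixes p q :: "'a::ab_group_add \<Rightarrow>\<^sub>0 real"
  shows "nonneg_coeffs p \<Longrightarrow> nonneg_coeffs q \<Longrightarrow> nonneg_coeffs (p * q)"
  unfolding mult_expand
  by (intro nonneg_coeffs_sum nonneg_coeffs_single) (simp add: nonneg_coeffs_def)

lemma nonneg_coeffs_power:
  fixes p :: "'a::ab_group_add \<Rightarrow>\<^sub>0 real"
  shows "nonneg_coeffs p \<Longrightarrow> nonneg_coeffs (p ^ n)"
  by (induction n) (simp_all add: nonneg_coeffs_one nonneg_coeffs_mult)

lemma nonneg_coeffs_prod:
  fixes p :: "'i \<Rightarrow> 'a::ab_group_add \<Rightarrow>\<^sub>0 real"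
  shows "(\<And>i. i \<in> I \<Longrightarrow> nonneg_coeffs (p i)) \<Longrightarrow> nonneg_coeffs (\<Prod>i\<in>I. p i)"
  by (induction I rule: infinite_finite_induct) (simp_all add: nonneg_coeffs_one nonneg_coeffs_mult)

text \<open>The ring homomorphism to \<open>\<complex>\<close> induced by a character \<open>\<theta>\<close>.\<close>

definition trig_eval :: "('a \<Rightarrow> complex) \<Rightarrow> ('a::ab_group_add \<Rightarrow>\<^sub>0 real) \<Rightarrow> complex" where
  "trig_eval \<theta> p = (\<Sum>x\<in>Poly_Mapping.keys p. of_real (Poly_Mapping.lookup p x) * \<theta> x)"

lemma trig_eval_superset:
  assumes "finite A" "Poly_Mapping.keys p \<subseteq> A"
  shows "trig_eval \<theta> p = (\<Sum>x\<in>A. of_real (Poly_Mapping.lookup p x) * \<theta> x)"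
  unfolding trig_eval_def using assms
  by (intro sum.mono_neutral_left) (auto simp: in_keys_iff)

lemma trig_eval_single: "trig_eval \<theta> (Poly_Mapping.single x r) = of_real r * \<theta> x"
  by (subst trig_eval_superset[of "{x}"]) auto

lemma trig_eval_add: "trig_eval \<theta> (p + q) = trig_eval \<theta> p + trig_eval \<theta> q"
proof -
  let ?A = "Poly_Mapping.keys p \<union> Poly_Mapping.keys q"
  have "Poly_Mapping.keys (p + q) \<subseteq> ?A" by (rule keys_add)
  then show ?thesis
    by (simp add: trig_eval_superset[of ?A] lookup_add sum.distrib distrib_right)
qed

lemma trig_eval_zero: "trig_eval \<theta> 0 = 0"
  by (simp add: trig_eval_def)

lemma trig_eval_diff: "trig_eval \<theta> (p - q) = trig_eval \<theta> p - trig_eval \<theta> q"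
  using trig_eval_add[of \<theta> "p - q" q] by simp

lemma trig_eval_sum: "trig_eval \<theta> (\<Sum>i\<in>I. p i) = (\<Sum>i\<in>I. trig_eval \<theta> (p i))"
  by (induction I rule: infinite_finite_induct) (simp_all add: trig_eval_zero trig_eval_add)

context
  fixes \<theta> :: "'a::ab_group_add \<Rightarrow> complex"
  assumes \<theta>: "\<theta> \<in> characters (discrete_topology UNIV)"
begin

lemma trig_eval_one: "trig_eval \<theta> 1 = 1"
  by (simp add: trig_eval_def character_zero[OF \<theta>])

lemma trig_eval_mult: "trig_eval \<theta> (p * q) = trig_eval \<theta> p * trig_eval \<theta> q"
  unfolding mult_expand
  by (simp add: trig_eval_sum trig_eval_single character_add[OF \<theta>])
    (simp add: trig_eval_def sum_product mult_ac)

lemma trig_eval_power: "trig_eval \<theta> (p ^ n) = trig_eval \<theta> p ^ n"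
  by (induction n) (simp_all add: trig_eval_one trig_eval_mult)

lemma trig_eval_prod: "trig_eval \<theta> (\<Prod>i\<in>I. p i) = (\<Prod>i\<in>I. trig_eval \<theta> (p i))"
  by (induction I rule: infinite_finite_induct) (simp_all add: trig_eval_one trig_eval_mult)

end

section \<open>Fejer kernels\<close>

abbreviation trig_monom :: "'a::ab_group_add \<Rightarrow> ('a \<Rightarrow>\<^sub>0 real)" where
  "trig_monom h \<equiv> Poly_Mapping.single h 1"

text \<open>Up to a factor \<open>N\<close>, the Fejer kernel in the variable \<open>h\<close>: as \<open>\<theta>(-h)\<close> is the conjugate of
  \<open>\<theta>(h)\<close>, it evaluates to the square of the modulus of \<open>1 + \<theta>(h) + \<dots> + \<theta>(h)\<^sup>N\<^sup>-\<^sup>1\<close>.\<close>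

definition fejer :: "nat \<Rightarrow> 'a::ab_group_add \<Rightarrow> ('a \<Rightarrow>\<^sub>0 real)" where
  "fejer N h = (\<Sum>i<N. trig_monom h ^ i) * (\<Sum>j<N. trig_monom (- h) ^ j)"

text \<open>Evaluates to the square of the distance between \<open>\<theta>(h)\<close> and 1.\<close>

definition sq_dist_one :: "'a::ab_group_add \<Rightarrow> ('a \<Rightarrow>\<^sub>0 real)" where
  "sq_dist_one h = (1 - trig_monom h) * (1 - trig_monom (- h))"

lemma trig_monom_inverse: "trig_monom h * trig_monom (- h) = (1 :: 'a::ab_group_add \<Rightarrow>\<^sub>0 real)"
  by (simp add: mult_single)

lemma trig_monom_inverse_power: "trig_monom h ^ i * trig_monom (- h) ^ i = (1 :: 'a::ab_group_add \<Rightarrow>\<^sub>0 real)"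
  by (simp add: trig_monom_inverse flip: power_mult_distrib)

text \<open>The geometric sums telescope, so the product has constant size although the kernel grows with
  \<open>N\<close>: this is how the Fejer kernel concentrates near 1.\<close>

lemma fejer_mult_sq_dist_one:
  "fejer N h * sq_dist_one h = 2 - trig_monom h ^ N - trig_monom (- h) ^ N"
proof -
  have "fejer N h * sq_dist_one h =
      ((1 - trig_monom h) * (\<Sum>i<N. trig_monom h ^ i)) *
      ((1 - trig_monom (- h)) * (\<Sum>i<N. trig_monom (- h) ^ i))"
    unfolding fejer_def sq_dist_one_def by (simp only: mult_ac)
  also have "\<dots> = (1 - trig_monom h ^ N) * (1 - trig_monom (- h) ^ N)"
    by (simp only: one_diff_power_eq)
  finally show ?thesis
    by (simp add: left_diff_distrib right_diff_distrib trig_monom_inverse_power)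
qed

lemma nonneg_coeffs_fejer: "nonneg_coeffs (fejer N h)"
  unfolding fejer_def
  by (intro nonneg_coeffs_mult nonneg_coeffs_sum nonneg_coeffs_power nonneg_coeffs_single) auto

lemma lookup_of_nat_mult:
  fixes p :: "'a::ab_group_add \<Rightarrow>\<^sub>0 real"
  shows "Poly_Mapping.lookup (of_nat n * p) x = of_nat n * Poly_Mapping.lookup p x"
  by (induction n) (simp_all add: distrib_right lookup_add)

text \<open>The \<open>N\<close> diagonal terms of the double sum contribute \<open>N\<close> copies of \<open>p\<close>, and the remaining terms
  have nonnegative coefficients: coincidences among the multiples of \<open>h\<close>, and between them and the
  frequencies of \<open>p\<close>, can only increase the constant term.\<close>

lemma constant_term_mult_fejer:
  fixes p :: "'a::ab_group_add \<Rightarrow>\<^sub>0 real"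
  assumes p: "nonneg_coeffs p"
  shows "N * Poly_Mapping.lookup p 0 \<le> Poly_Mapping.lookup (fejer N h * p) 0"
proof -
  let ?t = "\<lambda>i j. trig_monom h ^ i * trig_monom (- h) ^ j"
  let ?r = "\<Sum>i<N. \<Sum>j\<in>{..<N} - {i}. ?t i j"
  have "fejer N h = (\<Sum>i<N. \<Sum>j<N. ?t i j)"
    by (simp add: fejer_def sum_product)
  also have "\<dots> = (\<Sum>i<N. 1 + (\<Sum>j\<in>{..<N} - {i}. ?t i j))"
    by (intro sum.cong refl) (simp add: sum.remove trig_monom_inverse_power)
  finally have "fejer N h * p = of_nat N * p + ?r * p"
    by (simp add: sum.distrib distrib_right)
  moreover have "nonneg_coeffs (?r * p)"
    by (intro nonneg_coeffs_mult nonneg_coeffs_sum nonneg_coeffs_power nonneg_coeffs_single p) auto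
  ultimately show ?thesis
    by (simp add: lookup_add lookup_of_nat_mult nonneg_coeffs_def)
qed

lemma lookup_scalar_mult:
  fixes p :: "'a::ab_group_add \<Rightarrow>\<^sub>0 real"
  shows "Poly_Mapping.lookup (Poly_Mapping.single 0 r * p) x = r * Poly_Mapping.lookup p x"
  by (simp add: mult_map_scale_conv_mult[symmetric] Poly_Mapping.map.rep_eq when_def)

lemma constant_term_prod_fejer_pos:
  fixes F :: "'a::ab_group_add set"
  assumes "finite F" "N > 0"
  shows "0 < Poly_Mapping.lookup (\<Prod>h\<in>F. fejer N h) 0"
  using assms(1)
proof induction
  case (insert h F)
  have "0 < N * Poly_Mapping.lookup (\<Prod>h\<in>F. fejer N h) 0"
    using insert.IH assms(2) by simp
  also have "\<dots> \<le> Poly_Mapping.lookup (fejer N h * (\<Prod>h\<in>F. fejer N h)) 0"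
    by (intro constant_term_mult_fejer nonneg_coeffs_prod nonneg_coeffs_fejer)
  finally show ?case using insert.hyps by simp
qed simp

text \<open>In the mean with weight the product of the Fejer kernels, the squared distance from \<open>\<theta>(h)\<close> to 1 is
  at most \<open>2 / N\<close>: compare both sides with the product of the kernels of the other frequencies, using
  the telescoped product for the left one and the diagonal of the kernel of \<open>h\<close> for the right one.\<close>

lemma constant_term_prod_fejer_mult_sq_dist_one:
  fixes F :: "'a::ab_group_add set"
  assumes "finite F" "h \<in> F"
  shows "N * Poly_Mapping.lookup ((\<Prod>h\<in>F. fejer N h) * sq_dist_one h) 0
    \<le> 2 * Poly_Mapping.lookup (\<Prod>h\<in>F. fejer N h) 0"
proof -
  define R :: "'a \<Rightarrow>\<^sub>0 real" where "R = (\<Prod>h\<in>F - {h}. fejer N h)"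
  have R: "nonneg_coeffs R"
    unfolding R_def by (intro nonneg_coeffs_prod nonneg_coeffs_fejer)
  have P: "(\<Prod>h\<in>F. fejer N h) = fejer N h * R"
    using assms by (simp add: R_def prod.remove)
  have "(\<Prod>h\<in>F. fejer N h) * sq_dist_one h = R * (fejer N h * sq_dist_one h)"
    by (simp only: P mult_ac)
  also have "\<dots> = of_nat 2 * R - R * trig_monom h ^ N - R * trig_monom (- h) ^ N"
    unfolding fejer_mult_sq_dist_one by (simp add: algebra_simps)
  finally have "Poly_Mapping.lookup ((\<Prod>h\<in>F. fejer N h) * sq_dist_one h) 0 =
      2 * Poly_Mapping.lookup R 0 - Poly_Mapping.lookup (R * trig_monom h ^ N) 0
        - Poly_Mapping.lookup (R * trig_monom (- h) ^ N) 0"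
    by (simp only: lookup_minus lookup_of_nat_mult)
  moreover have "0 \<le> Poly_Mapping.lookup (R * trig_monom g ^ N) 0" for g
    using nonneg_coeffs_mult[OF R nonneg_coeffs_power[OF nonneg_coeffs_single[of 1 g]], of N]
    by (simp add: nonneg_coeffs_def)
  ultimately have "Poly_Mapping.lookup ((\<Prod>h\<in>F. fejer N h) * sq_dist_one h) 0 \<le> 2 * Poly_Mapping.lookup R 0"
    by (smt (verit))
  then have "N * Poly_Mapping.lookup ((\<Prod>h\<in>F. fejer N h) * sq_dist_one h) 0
      \<le> N * (2 * Poly_Mapping.lookup R 0)"
    by (rule mult_left_mono) simp
  also have "\<dots> = 2 * (N * Poly_Mapping.lookup R 0)"
    by simp
  also have "\<dots> \<le> 2 * Poly_Mapping.lookup (\<Prod>h\<in>F. fejer N h) 0"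
    using constant_term_mult_fejer[OF R] by (simp add: P)
  finally show ?thesis .
qed

lemma trig_eval_fejer:
  assumes "\<theta> \<in> characters (discrete_topology UNIV)"
  shows "trig_eval \<theta> (fejer N h) = of_real ((cmod (\<Sum>i<N. \<theta> h ^ i))\<^sup>2)"
  using assms complex_norm_square[of "\<Sum>i<N. \<theta> h ^ i"]
  by (simp add: fejer_def trig_eval_mult trig_eval_sum trig_eval_power trig_eval_single
      character_uminus)

lemma trig_eval_sq_dist_one:
  assumes "\<theta> \<in> characters (discrete_topology UNIV)"
  shows "trig_eval \<theta> (sq_dist_one h) = of_real ((cmod (1 - \<theta> h))\<^sup>2)"
  using assms complex_norm_square[of "1 - \<theta> h"]
  by (simp add: sq_dist_one_def trig_eval_mult trig_eval_diff trig_eval_one trig_eval_single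
      character_uminus)

section \<open>Simultaneous approximation\<close>

context separating_characters
begin

text \<open>The same as \<open>constant_term_nonneg\<close> on the coset of \<open>S\<close> translated by the conjugate of \<open>\<phi>\<close>; the
  translation multiplies the coefficients by values of a character and so fixes the constant term.\<close>

lemma lookup_zero_nonneg:
  assumes \<phi>: "\<phi> \<in> characters (discrete_topology UNIV)"
    and nonneg: "\<And>\<eta>. \<eta> \<in> S \<Longrightarrow> 0 \<le> Re (trig_eval (\<lambda>x. \<eta> x * cnj (\<phi> x)) p)"
  shows "0 \<le> Poly_Mapping.lookup p 0"
proof -
  let ?c = "\<lambda>x. of_real (Poly_Mapping.lookup p x) * cnj (\<phi> x)"
  have "0 \<le> Re (?c 0)"
  proof (rule constant_term_nonneg)
    fix \<eta> assume "\<eta> \<in> S"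
    have "(\<Sum>x\<in>insert 0 (Poly_Mapping.keys p). ?c x * \<eta> x) = trig_eval (\<lambda>x. \<eta> x * cnj (\<phi> x)) p"
      by (subst trig_eval_superset[of "insert 0 (Poly_Mapping.keys p)"]) (auto simp: mult_ac)
    with nonneg[OF \<open>\<eta> \<in> S\<close>] show "0 \<le> Re (\<Sum>x\<in>insert 0 (Poly_Mapping.keys p). ?c x * \<eta> x)"
      by simp
  qed auto
  then show ?thesis by (simp add: character_zero[OF \<phi>])
qed

text \<open>A Kronecker theorem. If every \<open>\<eta> \<in> S\<close> were far from \<open>\<phi>\<close> on \<open>F\<close>, the sum over \<open>F\<close> of the squared
  distances between \<open>\<eta> \<phi>\<^sup>-\<^sup>1\<close> and 1 would be at least \<open>e\<^sup>2\<close> everywhere on \<open>S\<close>, hence also in the mean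
  weighted by the Fejer kernels. But that mean is at most \<open>2 |F| / N\<close>, and \<open>N\<close> is arbitrary.\<close>

lemma simultaneous_approximation:
  assumes \<phi>: "\<phi> \<in> characters (discrete_topology UNIV)"
    and F: "finite F" and e: "0 < e"
  shows "\<exists>\<eta>\<in>S. \<forall>h\<in>F. cmod (\<eta> h - \<phi> h) < e"
proof -
  have "\<exists>\<eta>\<in>S. (\<Sum>h\<in>F. (cmod (1 - \<eta> h * cnj (\<phi> h)))\<^sup>2) < e\<^sup>2"
  proof (rule ccontr)
    assume "\<not> ?thesis"
    then have large: "e\<^sup>2 \<le> (\<Sum>h\<in>F. (cmod (1 - \<eta> h * cnj (\<phi> h)))\<^sup>2)" if "\<eta> \<in> S" for \<eta>
      using that by (auto simp: not_less)
    \<comment> \<open>So large that the bound \<open>2 |F| / N\<close> on the weighted mean is below \<open>e\<^sup>2\<close>.\<close>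
    obtain N where N: "2 * card F / e\<^sup>2 < real N" using reals_Archimedean2 by blast
    have "0 \<le> 2 * card F / e\<^sup>2" by simp
    with N have N0: "N > 0" by linarith
    define P where "P = (\<Prod>h\<in>F. fejer N h)"
    let ?ct = "\<lambda>p :: 'a \<Rightarrow>\<^sub>0 real. Poly_Mapping.lookup p 0"
    have P0: "0 < ?ct P"
      unfolding P_def using F N0 by (rule constant_term_prod_fejer_pos)
    \<comment> \<open>The lower bound: the polynomial is the weight times the excess of the sum over \<open>e\<^sup>2\<close>.\<close>
    have "0 \<le> ?ct (P * (\<Sum>h\<in>F. sq_dist_one h) - Poly_Mapping.single 0 (e\<^sup>2) * P)"
    proof (rule lookup_zero_nonneg[OF \<phi>])
      fix \<eta> assume \<eta>: "\<eta> \<in> S"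
      let ?\<theta> = "\<lambda>x. \<eta> x * cnj (\<phi> x)"
      have \<theta>: "?\<theta> \<in> characters (discrete_topology UNIV)"
        using \<eta> S_characters \<phi> by (auto simp: characters_discrete norm_mult mult_ac)
      define r where "r = (\<Prod>h\<in>F. (cmod (\<Sum>i<N. ?\<theta> h ^ i))\<^sup>2)"
      have "0 \<le> r" unfolding r_def by (intro prod_nonneg) simp
      have "trig_eval ?\<theta> P = of_real r"
        unfolding P_def r_def by (simp add: trig_eval_prod[OF \<theta>] trig_eval_fejer[OF \<theta>])
      then have "trig_eval ?\<theta> (P * (\<Sum>h\<in>F. sq_dist_one h) - Poly_Mapping.single 0 (e\<^sup>2) * P) =
          of_real (r * ((\<Sum>h\<in>F. (cmod (1 - ?\<theta> h))\<^sup>2) - e\<^sup>2))"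
        by (simp add: trig_eval_diff trig_eval_mult[OF \<theta>] trig_eval_sum trig_eval_sq_dist_one[OF \<theta>]
            trig_eval_single character_zero[OF \<theta>, simplified] right_diff_distrib)
      moreover have "0 \<le> r * ((\<Sum>h\<in>F. (cmod (1 - ?\<theta> h))\<^sup>2) - e\<^sup>2)"
        using \<open>0 \<le> r\<close> large[OF \<eta>] by simp
      ultimately show "0 \<le> Re (trig_eval ?\<theta> (P * (\<Sum>h\<in>F. sq_dist_one h) - Poly_Mapping.single 0 (e\<^sup>2) * P))"
        by simp
    qed
    also have "?ct (P * (\<Sum>h\<in>F. sq_dist_one h) - Poly_Mapping.single 0 (e\<^sup>2) * P)
        = (\<Sum>h\<in>F. ?ct (P * sq_dist_one h)) - e\<^sup>2 * ?ct P"
      by (simp add: lookup_minus sum_distrib_left lookup_sum lookup_scalar_mult)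
    finally have "N * (e\<^sup>2 * ?ct P) \<le> N * (\<Sum>h\<in>F. ?ct (P * sq_dist_one h))"
      by (intro mult_left_mono) auto
    also have "\<dots> = (\<Sum>h\<in>F. N * ?ct (P * sq_dist_one h))"
      by (rule sum_distrib_left)
    also have "\<dots> \<le> (\<Sum>h\<in>F. 2 * ?ct P)"
      unfolding P_def by (intro sum_mono constant_term_prod_fejer_mult_sq_dist_one F)
    finally have "(N * e\<^sup>2) * ?ct P \<le> (2 * card F) * ?ct P" by (simp add: mult_ac)
    then have "N * e\<^sup>2 \<le> 2 * card F" using P0 by simp
    with N e show False by (simp add: field_simps)
  qed
  then obtain \<eta> where \<eta>: "\<eta> \<in> S" and small: "(\<Sum>h\<in>F. (cmod (1 - \<eta> h * cnj (\<phi> h)))\<^sup>2) < e\<^sup>2"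
    by blast
  show ?thesis
  proof (intro bexI ballI)
    fix h assume h: "h \<in> F"
    have "\<eta> h - \<phi> h = - (1 - \<eta> h * cnj (\<phi> h)) * \<phi> h"
      using character_norm[OF \<phi>, of h] complex_norm_square[of "\<phi> h"] by (simp add: algebra_simps)
    then have "cmod (\<eta> h - \<phi> h) = cmod (1 - \<eta> h * cnj (\<phi> h))"
      by (simp only: norm_mult norm_minus_cancel character_norm[OF \<phi>] mult_1_right)
    moreover have "(cmod (1 - \<eta> h * cnj (\<phi> h)))\<^sup>2 < e\<^sup>2"
      using small member_le_sum[OF h, of "\<lambda>h. (cmod (1 - \<eta> h * cnj (\<phi> h)))\<^sup>2"] F by simp
    ultimately show "cmod (\<eta> h - \<phi> h) < e"
      using e by (simp add: power2_less_imp_less)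
  qed (rule \<eta>)
qed

end

section \<open>Continuous characters and density in the dual group\<close>

text \<open>The initial topology of a character: the test topologies against which the finest one is compared.\<close>

lemma group_topology_pullback:
  fixes \<phi> :: "'a::ab_group_add \<Rightarrow> complex"
  assumes "\<phi> \<in> characters (discrete_topology UNIV)"
  shows "group_topology (pullback_topology UNIV \<phi> euclidean)" (is "group_topology ?T")
proof -
  have top: "topspace ?T = UNIV" by (simp add: topspace_pullback_topology)
  have \<phi>: "continuous_map ?T euclidean \<phi>"
    using continuous_map_pullback[of euclidean euclidean id UNIV \<phi>] by simp
  have "continuous_map (prod_topology ?T ?T) (prod_topology euclidean euclidean) (\<lambda>(x, y). (\<phi> x, \<phi> y))"
    unfolding continuous_map_prod_top using \<phi> by blast
  moreover have "continuous_map (prod_topology euclidean euclidean) euclidean (\<lambda>(x, y). x * y :: complex)"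
    by (auto simp: case_prod_unfold intro!: continuous_intros)
  ultimately have "continuous_map (prod_topology ?T ?T) euclidean ((\<lambda>(x, y). x * y) \<circ> (\<lambda>(x, y). (\<phi> x, \<phi> y)))"
    by (rule continuous_map_compose)
  also have "(\<lambda>(x, y). x * y) \<circ> (\<lambda>(x, y). (\<phi> x, \<phi> y)) = \<phi> \<circ> (\<lambda>(x, y). x + y)"
    by (auto simp: fun_eq_iff character_add[OF assms])
  finally have add: "continuous_map (prod_topology ?T ?T) ?T (\<lambda>(x, y). x + y)"
    by (rule continuous_map_pullback') auto
  have "continuous_map ?T euclidean (cnj \<circ> \<phi>)"
    by (rule continuous_map_compose[OF \<phi>]) (auto intro!: continuous_intros)
  also have "cnj \<circ> \<phi> = \<phi> \<circ> uminus"
    by (simp add: fun_eq_iff character_uminus[OF assms])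
  finally have "continuous_map ?T ?T uminus"
    by (rule continuous_map_pullback') auto
  with top add show ?thesis by (simp add: group_topology_def)
qed

text \<open>A continuous character sends the null sequence \<open>u\<close> to a sequence with limit 1. Conversely, if
  \<open>\<phi> (u n)\<close> tends to 1, then \<open>u\<close> is a null sequence for the initial topology of \<open>\<phi>\<close>, so the finest such
  topology refines it and \<open>\<phi>\<close> is continuous.\<close>

lemma characters_finest_null_topology:
  fixes u :: "nat \<Rightarrow> 'a::ab_group_add"
  assumes "T_sequence u"
  shows "characters (finest_null_topology u) = s_set u"
proof
  let ?N = "finest_null_topology u"
  have N: "group_topology ?N" "limitin ?N u 0 sequentially"
    and finest: "\<And>S U. group_topology S \<Longrightarrow> limitin S u 0 sequentially \<Longrightarrow> openin S U \<Longrightarrow> openin ?N U"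
    using finest_null_topology[OF assms] unfolding is_finest_null_topology_def by blast+
  have top: "topspace ?N = UNIV" using N(1) by (simp add: group_topology_def)
  show "characters ?N \<subseteq> s_set u"
  proof
    fix \<phi> assume "\<phi> \<in> characters ?N"
    then have cont: "continuous_map ?N euclidean \<phi>" and \<phi>: "\<phi> \<in> characters (discrete_topology UNIV)"
      by (auto simp: characters_def continuous_map_in_subtopology top)
    have "limitin euclidean (\<phi> \<circ> u) (\<phi> 0) sequentially"
      by (rule continuous_map_limit[OF cont N(2)])
    with \<phi> show "\<phi> \<in> s_set u"
      by (simp add: s_set_def topspace_dual_topology character_zero o_def)
  qed
  show "s_set u \<subseteq> characters ?N"
  proof
    fix \<phi> assume "\<phi> \<in> s_set u"
    then have \<phi>: "\<phi> \<in> characters (discrete_topology UNIV)" and lim: "(\<lambda>n. \<phi> (u n)) \<longlonglongrightarrow> \<phi> 0"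
      by (auto simp: s_set_def topspace_dual_topology character_zero)
    let ?T = "pullback_topology UNIV \<phi> euclidean"
    have "limitin ?T u 0 sequentially"
      using lim by (auto simp: limitin_def topspace_pullback_topology openin_pullback_topology tendsto_def)
    then have "openin ?N (\<phi> -` V)" if "open V" for V
      using finest[OF group_topology_pullback[OF \<phi>]] that by (auto simp: openin_pullback_topology)
    then have "continuous_map ?N euclidean \<phi>"
      by (simp add: continuous_map_alt top)
    with \<phi> show "\<phi> \<in> characters ?N"
      by (auto simp: characters_def continuous_map_in_subtopology top)
  qed
qed

text \<open>Compact subsets of a discrete space are finite, so the compact-open topology on the dual of a
  discrete group is that of pointwise convergence.\<close>

lemma discrete_dual_nbhd:
  fixes \<phi> :: "'a::ab_group_add \<Rightarrow> complex"
  assumes "openin discrete_dual U" "\<phi> \<in> U"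
  shows "\<exists>F e. finite F \<and> 0 < e \<and>
    (\<forall>\<psi>\<in>characters (discrete_topology UNIV). (\<forall>h\<in>F. cmod (\<psi> h - \<phi> h) < e) \<longrightarrow> \<psi> \<in> U)"
proof -
  let ?G = "characters (discrete_topology (UNIV :: 'a set))"
  let ?\<B> = "{{\<phi> \<in> ?G. \<phi> ` K \<subseteq> V} | K V. compactin (discrete_topology (UNIV :: 'a set)) K \<and> openin (top_of_set (sphere 0 1)) V}"
  let ?near = "\<lambda>U F e. finite F \<and> 0 < e \<and> (\<forall>\<psi>\<in>?G. (\<forall>h\<in>F. cmod (\<psi> h - \<phi> h) < e) \<longrightarrow> \<psi> \<in> U)"
  have "generate_topology_on ?\<B> U"
    using assms(1) by (simp add: dual_topology_def openin_topology_generated_by_iff)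
  then have "\<phi> \<in> U \<longrightarrow> (\<exists>F e. ?near U F e)"
  proof induction
    case Empty
    then show ?case by simp
  next
    case (Int U V)
    show ?case
    proof
      assume "\<phi> \<in> U \<inter> V"
      with Int.IH obtain F d F' e where "?near U F d" "?near V F' e" by blast
      then have "?near (U \<inter> V) (F \<union> F') (min d e)" by auto
      then show "\<exists>F e. ?near (U \<inter> V) F e" by blast
    qed
  next
    case (UN \<U>)
    show ?case
    proof
      assume "\<phi> \<in> \<Union>\<U>"
      then obtain U where "U \<in> \<U>" "\<phi> \<in> U" by blast
      with UN.IH obtain F e where "?near U F e" by blast
      with \<open>U \<in> \<U>\<close> have "?near (\<Union>\<U>) F e" by blast
      then show "\<exists>F e. ?near (\<Union>\<U>) F e" by blast
    qed
  next
    case (Basis B)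
    then obtain K V where B: "B = {\<phi> \<in> ?G. \<phi> ` K \<subseteq> V}" "finite K"
      and V: "openin (top_of_set (sphere 0 1)) V"
      by (auto simp: compactin_discrete_topology)
    obtain W where W: "open W" "V = sphere 0 1 \<inter> W"
      using V by (auto simp: openin_open)
    show ?case
    proof
      assume "\<phi> \<in> B"
      then have "\<forall>h\<in>K. \<exists>e>0. ball (\<phi> h) e \<subseteq> W"
        using W by (auto simp: B(1) open_contains_ball)
      then obtain e where e: "\<And>h. h \<in> K \<Longrightarrow> 0 < e h \<and> ball (\<phi> h) (e h) \<subseteq> W" by metis
      have "?near B K (Min (insert 1 (e ` K)))"
      proof (intro conjI ballI impI)
        show "0 < Min (insert 1 (e ` K))" using B(2) e by auto
      next
        fix \<psi> assume \<psi>: "\<psi> \<in> ?G" and close: "\<forall>h\<in>K. cmod (\<psi> h - \<phi> h) < Min (insert 1 (e ` K))"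
        have "\<psi> h \<in> V" if "h \<in> K" for h
        proof -
          have "cmod (\<psi> h - \<phi> h) < e h" using close that B(2) by auto
          then have "\<psi> h \<in> W" using e[OF that] by (auto simp: dist_norm norm_minus_commute)
          then show ?thesis using character_norm[OF \<psi>] by (simp add: W(2))
        qed
        with \<psi> show "\<psi> \<in> B" by (auto simp: B(1))
      qed (rule B(2))
      then show "\<exists>F e. ?near B F e" by blast
    qed
  qed
  with assms(2) show ?thesis by blast
qed

lemma von_Neumann_radical_iff:
  "x \<in> von_Neumann_radical T \<longleftrightarrow> (\<forall>\<phi>\<in>characters T. \<phi> x = 1)"
  by (simp add: von_Neumann_radical_def)

lemma trivial_character_in_s_set: "trivial_character \<in> s_set u"
  by (simp add: s_set_def topspace_dual_topology characters_discrete trivial_character_def)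

lemma s_set_mult: "\<phi> \<in> s_set u \<Longrightarrow> \<psi> \<in> s_set u \<Longrightarrow> (\<lambda>x. \<phi> x * \<psi> x) \<in> s_set u"
  using tendsto_mult[of "\<lambda>n. \<phi> (u n)" 1 sequentially "\<lambda>n. \<psi> (u n)" 1]
  by (auto simp: s_set_def topspace_dual_topology characters_discrete norm_mult mult_ac)

text \<open>A dense set separates points because the characters of a discrete group do, and because taking a
  value other than 1 at a given point is an open condition. The converse is simultaneous approximation.\<close>

lemma dense_iff_separating:
  fixes u :: "nat \<Rightarrow> 'a::ab_group_add"
  shows "discrete_dual closure_of (s_set u) = topspace discrete_dual \<longleftrightarrow>
    (\<forall>x. x \<noteq> 0 \<longrightarrow> (\<exists>\<phi>\<in>s_set u. \<phi> x \<noteq> 1))"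
proof
  assume dense: "discrete_dual closure_of (s_set u) = topspace discrete_dual"
  show "\<forall>x. x \<noteq> 0 \<longrightarrow> (\<exists>\<phi>\<in>s_set u. \<phi> x \<noteq> 1)"
  proof (intro allI impI)
    fix x :: 'a assume "x \<noteq> 0"
    then have "x \<notin> group_closure {}" by simp
    from character_separating_subgroup[OF this]
    obtain \<phi> where \<phi>: "\<phi> \<in> characters (discrete_topology UNIV)" "\<phi> x \<noteq> 1"
      by blast
    let ?U = "{\<psi> \<in> characters (discrete_topology UNIV). \<psi> ` {x} \<subseteq> sphere 0 1 - {1}}"
    have "openin (top_of_set (sphere 0 1)) (sphere 0 1 - {1 :: complex})"
      by (intro openin_delete openin_subtopology_self)
    moreover have "compactin (discrete_topology UNIV) {x}"
      by (simp add: compactin_discrete_topology)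
    ultimately have U_open: "openin discrete_dual ?U"
      unfolding dual_topology_def
      by (intro topology_generated_by_Basis CollectI exI[of _ "{x}"] exI[of _ "sphere 0 1 - {1}"]) simp
    have "\<phi> \<in> ?U" using \<phi> by (simp add: character_norm)
    have "\<phi> \<in> discrete_dual closure_of (s_set u)"
      using \<phi> by (simp add: dense topspace_dual_topology)
    then have "\<forall>T. \<phi> \<in> T \<and> openin discrete_dual T \<longrightarrow> (\<exists>\<psi>. \<psi> \<in> s_set u \<and> \<psi> \<in> T)"
      unfolding in_closure_of by (rule conjunct2)
    from this[rule_format, OF conjI[OF \<open>\<phi> \<in> ?U\<close> U_open]]
    obtain \<psi> where "\<psi> \<in> s_set u" "\<psi> \<in> ?U" by (elim exE conjE)
    then show "\<exists>\<phi>\<in>s_set u. \<phi> x \<noteq> 1" by auto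
  qed
next
  assume sep: "\<forall>x. x \<noteq> 0 \<longrightarrow> (\<exists>\<phi>\<in>s_set u. \<phi> x \<noteq> 1)"
  interpret separating_characters "s_set u"
  proof
    show "s_set u \<subseteq> characters (discrete_topology UNIV)"
      by (auto simp: s_set_def topspace_dual_topology)
    show "s_set u \<noteq> {}" using trivial_character_in_s_set by blast
  qed (use sep s_set_mult in auto)
  have "\<phi> \<in> discrete_dual closure_of (s_set u)" if \<phi>: "\<phi> \<in> topspace discrete_dual" for \<phi>
    unfolding in_closure_of
  proof (intro conjI allI impI)
    fix U assume "\<phi> \<in> U \<and> openin discrete_dual U"
    then obtain F e where F: "finite F" "0 < e"
      and near: "\<forall>\<psi>\<in>characters (discrete_topology UNIV). (\<forall>h\<in>F. cmod (\<psi> h - \<phi> h) < e) \<longrightarrow> \<psi> \<in> U"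
      using discrete_dual_nbhd[of U \<phi>] by blast
    have char: "\<phi> \<in> characters (discrete_topology UNIV)" using \<phi> by (simp add: topspace_dual_topology)
    obtain \<psi> where "\<psi> \<in> s_set u" "\<forall>h\<in>F. cmod (\<psi> h - \<phi> h) < e"
      using simultaneous_approximation[OF char F] by blast
    with near S_characters show "\<exists>\<psi>. \<psi> \<in> s_set u \<and> \<psi> \<in> U" by blast
  qed (rule \<phi>)
  then show "discrete_dual closure_of (s_set u) = topspace discrete_dual"
    by (intro equalityI closure_of_subset_topspace subsetI)
qed

theorem corollary2:
  fixes u :: "nat \<Rightarrow> 'a::ab_group_add"
  assumes "T_sequence u"
  shows "(maximally_almost_periodic (finest_null_topology u) \<longleftrightarrow>
            discrete_dual closure_of (s_set u) = topspace discrete_dual) \<and>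
         (minimally_almost_periodic (finest_null_topology u) \<longleftrightarrow>
            group_closure (range u) = UNIV \<and> s_set u = {trivial_character})"
proof
  let ?N = "finest_null_topology u"
  note chars = characters_finest_null_topology[OF assms]
  have radical: "x \<in> von_Neumann_radical ?N \<longleftrightarrow> (\<forall>\<phi>\<in>s_set u. \<phi> x = 1)" for x
    by (simp add: von_Neumann_radical_iff chars)
  have zero: "0 \<in> von_Neumann_radical ?N"
    by (auto simp: radical s_set_def topspace_dual_topology character_zero)
  show "maximally_almost_periodic ?N \<longleftrightarrow> discrete_dual closure_of (s_set u) = topspace discrete_dual"
    unfolding maximally_almost_periodic_def dense_iff_separating
    using zero radical by blast
  have top: "topspace ?N = UNIV"
    using finest_null_topology[OF assms] by (simp add: is_finest_null_topology_def group_topology_def)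
  have min: "minimally_almost_periodic ?N \<longleftrightarrow> s_set u = {trivial_character}"
  proof
    assume "minimally_almost_periodic ?N"
    then have "\<phi> = trivial_character" if "\<phi> \<in> s_set u" for \<phi>
      using that radical by (auto simp: minimally_almost_periodic_def top trivial_character_def)
    with trivial_character_in_s_set show "s_set u = {trivial_character}" by blast
  next
    assume "s_set u = {trivial_character}"
    then have "x \<in> von_Neumann_radical ?N" for x
      by (simp add: radical trivial_character_def)
    then show "minimally_almost_periodic ?N"
      by (auto simp: minimally_almost_periodic_def top)
  qed
  moreover have "group_closure (range u) = UNIV" if trivial: "s_set u = {trivial_character}"
  proof (rule ccontr)
    assume "group_closure (range u) \<noteq> UNIV"
    then obtain x where x: "x \<notin> group_closure (range u)" by blast
    from character_separating_subgroup[OF x]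
    obtain \<phi> where \<phi>: "\<phi> \<in> characters (discrete_topology UNIV)" "\<forall>s\<in>range u. \<phi> s = 1" "\<phi> x \<noteq> 1"
      by blast
    then have "\<phi> \<in> s_set u" by (simp add: s_set_def topspace_dual_topology)
    with trivial \<phi>(3) show False by (simp add: trivial_character_def)
  qed
  ultimately show "minimally_almost_periodic ?N \<longleftrightarrow>
      group_closure (range u) = UNIV \<and> s_set u = {trivial_character}"
    by blast
qed

end
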